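(* Let $p\in\mathbb{R}^+$ and let $V_p$ be the penalized value function. Assume that the following zeroth-order condition holds: $$\sup_{\mathcal{X}_U}V_p<\inf_{\mathcal{X}_V}V\quad\text{if }\mathbb{T}=\mathbb{R}^+,$$ $$R_{\mathcal{Q}_U}+\gamma\cdot\sup_{\mathcal{X}_U}V_p<R_{\mathcal{Q}_V}+\gamma\cdot\inf_{\mathcal{X}_V}V\quad\text{if }\mathbb{T}=\mathbb{N}.$$ Then $V_p$ is a safe value function, i.e., every optimal controller of $V_p$ is safe and is optimal for the constrained problem $(\mathcal{C})$.
   Context: Time set and dynamics. $\mathbb{T}$ is either $\mathbb{R}^+=[0,\infty)$ (with Lebesgue measure) or $\mathbb{N}$ (with counting measure); integrals over $\mathbb{T}$ use the corresponding measure. The state space is $\mathcal{X}\subset\mathbb{R}^n$ and the control space is $\mathcal{U}\subset\mathbb{R}^m$ (in discrete time more general, e.g. finite, sets are allowed). $\mathfrak{U}$ is the set of measurable feedback controllers $u:\mathcal{X}\to\mathcal{U}$. The dynamics are $\dot x(t)=f(x(t),u(x(t)))$ if $\mathbb{T}=\mathbb{R}^+$, and $x_{t+1}=f(x_t,u(x_t))$ if $\mathbb{T}=\mathbb{N}$. $\phi_x^u$ denotes the trajectory starting at $x$ under $u\in\mathfrak{U}$; trajectories are assumed well defined for all time, and continuous if $\mathbb{T}=\mathbb{R}^+$. Failure. $\mathcal{X}_F\subset\mathcal{X}$ is a closed absorbing failure set. The time to failure is $t_f(x,u)=\inf\{t\in\mathbb{T}:\phi_x^u(t)\in\mathcal{X}_F\}\in\mathbb{T}\cup\{\infty\}$.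 When the trajectory reaches $\mathcal{X}_F$ the system instantly transitions (in discrete time: at the next step) to an invariant sink state, not counted as an element of $\mathcal{X}$, where no reward or penalty is collected. Viability. $\mathcal{X}_V=\{x\in\mathcal{X}:\exists u\in\mathfrak{U},\forall t\in\mathbb{T},\ \phi_x^u(t)\notin\mathcal{X}_F\}$ is the viability kernel and $\mathcal{X}_U=\mathcal{X}\setminus\mathcal{X}_V$. A controller $u$ is safe for $x$ if $\phi_x^u(t)\notin\mathcal{X}_F$ for all $t\in\mathbb{T}$; $\mathfrak{U}_{\mathrm{safe}}(x)$ is the set of controllers safe for $x$; $\mathfrak{U}_{\mathrm{safe}}=\bigcap_{x\in\mathcal{X}_V}\mathfrak{U}_{\mathrm{safe}}(x)$ is the set of safe controllers. Return and risk. $r:\mathcal{X}\times\mathcal{U}\to\mathbb{R}$ is bounded and measurable, $\tau>0$ is the discount rate, and $\gamma=e^{-1/\tau}$. The return is $G(x,u)=\int_{\mathbb{T}}e^{-t/\tau}r(\phi_x^u(t),u(\phi_x^u(t)))\,dt$. The discounted risk is $\rho(x,u)=\int_{\mathbb{T}}e^{-t/\tau}\delta_{\mathcal{X}_F}(\phi_x^u(t))\,dt$, with $\delta_{\mathcal{X}_F}$ the Dirac distribution (continuous time) or indicator function (discrete time) of $\mathcal{X}_F$; this is understood as $\rho(x,u)=e^{-t_f(x,u)/\tau}$ (equal to $0$ if $t_f=\infty$). Problems and value functions. The constrained problem $(\mathcal{C})$ is $\sup_{u\in\mathfrak{U}_{\mathrm{safe}}}\mathbb{E}_{x\sim\mu}[G(x,u)]$,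 where $\mu$ is a probability distribution on initial states with support included in $\mathcal{X}_V$. The constrained value function is $V(x)=\sup_{u\in\mathfrak{U}_{\mathrm{safe}}}G(x,u)$ for $x\in\mathcal{X}_V$. The penalized value function is $V_p(x)=\sup_{u\in\mathfrak{U}}\big(G(x,u)-p\,\rho(x,u)\big)$ for $x\in\mathcal{X}$; the supremum is assumed attained, and controllers $u\in\mathfrak{U}$ attaining it for all $x$ are called optimal controllers of $V_p$. $V_p$ is called a safe value function (or "safe") if all of its optimal controllers are both safe (in $\mathfrak{U}_{\mathrm{safe}}$) and optimal with respect to $(\mathcal{C})$. For $\mathbb{T}=\mathbb{N}$: $\mathcal{Q}_V=f^{-1}(\mathcal{X}_V)\subset\mathcal{X}_V\times\mathcal{U}$ is the set of state-control pairs mapped by $f$ into $\mathcal{X}_V$, $\mathcal{Q}_U=(\mathcal{X}\times\mathcal{U})\setminus\mathcal{Q}_V$, $R_{\mathcal{Q}_U}=\sup_{\mathcal{Q}_U}r$, and $R_{\mathcal{Q}_V}=\inf_{\mathcal{Q}_V}r$. *)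

theory Defs
  imports "HOL-Probability.Probability"
begin

text \<open>
  Both time sets are treated at once: the points of \<^term>\<open>time P\<close> are the times, its measure is the one
  used for integration over time, and \<^term>\<open>clock P\<close> embeds times into the reals.  States along a
  trajectory have type \<^typ>\<open>'x option\<close>; the value \<^term>\<open>None\<close> is the sink state, which does not belong
  to the state space and in which nothing is collected.
\<close>

record ('t, 'x, 'u) control_problem =
  "time" :: "'t measure"
  clock :: "'t \<Rightarrow> real"
  states :: "'x set"
  failure :: "'x set"
  feedbacks :: "('x \<Rightarrow> 'u) set"
  trajectory :: "('x \<Rightarrow> 'u) \<Rightarrow> 'x \<Rightarrow> 't \<Rightarrow> 'x option"
  reward :: "'x \<Rightarrow> 'u \<Rightarrow> real"
  discount_rate :: real

definition safe_for :: "('t, 'x, 'u) control_problem \<Rightarrow> ('x \<Rightarrow> 'u) \<Rightarrow> 'x \<Rightarrow> bool" where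
  "safe_for P u x \<longleftrightarrow> (\<forall>t\<in>space (time P). trajectory P u x t \<notin> Some ` failure P)"

definition viability_kernel :: "('t, 'x, 'u) control_problem \<Rightarrow> 'x set" where
  "viability_kernel P = {x \<in> states P. \<exists>u\<in>feedbacks P. safe_for P u x}"

definition unviable_states :: "('t, 'x, 'u) control_problem \<Rightarrow> 'x set" where
  "unviable_states P = states P - viability_kernel P"

definition safe_feedbacks :: "('t, 'x, 'u) control_problem \<Rightarrow> ('x \<Rightarrow> 'u) set" where
  "safe_feedbacks P = {u \<in> feedbacks P. \<forall>x\<in>viability_kernel P. safe_for P u x}"

definition time_to_failure :: "('t, 'x, 'u) control_problem \<Rightarrow> 'x \<Rightarrow> ('x \<Rightarrow> 'u) \<Rightarrow> ereal" where
  "time_to_failure P x u =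
     Inf {ereal (clock P t) |t. t \<in> space (time P) \<and> trajectory P u x t \<in> Some ` failure P}"

definition gain :: "('t, 'x, 'u) control_problem \<Rightarrow> 'x \<Rightarrow> ('x \<Rightarrow> 'u) \<Rightarrow> real" where
  "gain P x u =
     (LINT t|time P. exp (- clock P t / discount_rate P) *
        (case trajectory P u x t of None \<Rightarrow> 0 | Some y \<Rightarrow> reward P y (u y)))"

definition risk :: "('t, 'x, 'u) control_problem \<Rightarrow> 'x \<Rightarrow> ('x \<Rightarrow> 'u) \<Rightarrow> real" where
  "risk P x u =
     (if time_to_failure P x u = \<infinity> then 0
      else exp (- real_of_ereal (time_to_failure P x u) / discount_rate P))"

text \<open>
  Value functions are extended real-valued, so that a supremum over an empty set of controllers
  is \<^term>\<open>- \<infinity> :: ereal\<close>.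
\<close>

definition constrained_value :: "('t, 'x, 'u) control_problem \<Rightarrow> 'x \<Rightarrow> ereal" where
  "constrained_value P x = (SUP u\<in>safe_feedbacks P. ereal (gain P x u))"

definition penalized_value :: "('t, 'x, 'u) control_problem \<Rightarrow> real \<Rightarrow> 'x \<Rightarrow> ereal" where
  "penalized_value P p x = (SUP u\<in>feedbacks P. ereal (gain P x u - p * risk P x u))"

definition penalized_value_attained :: "('t, 'x, 'u) control_problem \<Rightarrow> real \<Rightarrow> bool" where
  "penalized_value_attained P p \<longleftrightarrow>
     (\<forall>x\<in>states P. \<exists>u\<in>feedbacks P. ereal (gain P x u - p * risk P x u) = penalized_value P p x)"

definition penalized_optimal :: "('t, 'x, 'u) control_problem \<Rightarrow> real \<Rightarrow> ('x \<Rightarrow> 'u) \<Rightarrow> bool" where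
  "penalized_optimal P p u \<longleftrightarrow>
     u \<in> feedbacks P \<and>
     (\<forall>x\<in>states P. ereal (gain P x u - p * risk P x u) = penalized_value P p x)"

definition initial_distribution ::
    "('t, 'x::topological_space, 'u) control_problem \<Rightarrow> 'x measure \<Rightarrow> bool" where
  "initial_distribution P \<mu> \<longleftrightarrow>
     prob_space \<mu> \<and> sets \<mu> = sets (restrict_space borel (states P)) \<and>
     (AE x in \<mu>. x \<in> viability_kernel P)"

text \<open>
  The expected return is the integral of the positive part minus that of the negative part.  It
  equals the Bochner integral whenever the return is an integrable function of the initial state.
  If the return is not measurable in the initial state, the Bochner integral would be 0 by
  convention, which says nothing about the return; this expression remains monotone.
\<close>

definition expected_gain ::
    "('t, 'x, 'u) control_problem \<Rightarrow> 'x measure \<Rightarrow> ('x \<Rightarrow> 'u) \<Rightarrow> ereal" where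
  "expected_gain P \<mu> u =
     enn2ereal (\<integral>\<^sup>+ x. ennreal (gain P x u) \<partial>\<mu>) - enn2ereal (\<integral>\<^sup>+ x. ennreal (- gain P x u) \<partial>\<mu>)"

definition constrained_optimal ::
    "('t, 'x, 'u) control_problem \<Rightarrow> 'x measure \<Rightarrow> ('x \<Rightarrow> 'u) \<Rightarrow> bool" where
  "constrained_optimal P \<mu> u \<longleftrightarrow>
     u \<in> safe_feedbacks P \<and> expected_gain P \<mu> u = (SUP v\<in>safe_feedbacks P. expected_gain P \<mu> v)"

definition safe_value_function ::
    "('t, 'x, 'u) control_problem \<Rightarrow> 'x measure \<Rightarrow> real \<Rightarrow> bool" where
  "safe_value_function P \<mu> p \<longleftrightarrow>
     (\<forall>u. penalized_optimal P p u \<longrightarrow> u \<in> safe_feedbacks P \<and> constrained_optimal P \<mu> u)"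

definition failure_set ::
    "'x::topological_space set \<Rightarrow> 'x set \<Rightarrow> bool" where
  "failure_set X XF \<longleftrightarrow> XF \<subseteq> X \<and> closedin (top_of_set X) XF"

definition bounded_measurable_reward ::
    "'x::topological_space set \<Rightarrow> 'u::topological_space set \<Rightarrow> ('x \<Rightarrow> 'u \<Rightarrow> real) \<Rightarrow> bool" where
  "bounded_measurable_reward X U r \<longleftrightarrow>
     bounded ((\<lambda>(x, a). r x a) ` (X \<times> U)) \<and>
     (\<lambda>(x, a). r x a) \<in> borel_measurable (restrict_space borel X \<Otimes>\<^sub>M restrict_space borel U)"

definition measurable_feedbacks ::
    "'x::topological_space set \<Rightarrow> 'u::topological_space set \<Rightarrow> ('x \<Rightarrow> 'u) set" where
  "measurable_feedbacks X U = measurable (restrict_space borel X) (restrict_space borel U)"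


subsection \<open>Continuous time\<close>

text \<open>
  A measurable feedback may be discontinuous, so the closed-loop equation is taken in integral
  form.  The gauge integral covers both everywhere differentiable solutions and Caratheodory
  solutions.  A trajectory that is in the failure set at some time is in the sink state at all
  later times; in particular it is in the failure set at no more than one time, and the equation is
  required up to and including that time.
\<close>

definition is_trajectory ::
    "'x::euclidean_space set \<Rightarrow> 'x set \<Rightarrow> ('x \<Rightarrow> 'u \<Rightarrow> 'x) \<Rightarrow> ('x \<Rightarrow> 'u) \<Rightarrow> 'x \<Rightarrow>
      (real \<Rightarrow> 'x option) \<Rightarrow> bool" where
  "is_trajectory X XF f u x \<phi> \<longleftrightarrow>
     \<phi> \<in> extensional {0..} \<and> \<phi> 0 = Some x \<and>
     (\<forall>t\<ge>0. \<phi> t = None \<longleftrightarrow> (\<exists>s\<in>{0..<t}. \<phi> s \<in> Some ` XF)) \<and>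
     (let z = (\<lambda>t. the (\<phi> t)); I = {t. 0 \<le> t \<and> \<phi> t \<noteq> None} in
        z ` I \<subseteq> X \<and> continuous_on I z \<and>
        (\<forall>t\<in>I. ((\<lambda>s. f (z s) (u (z s))) has_integral (z t - x)) {0..t}))"

text \<open>
  The controllers are the measurable feedbacks for which trajectories are well defined for all time:
  from every initial state there is exactly one.
\<close>

definition continuous_time_problem ::
    "'x::euclidean_space set \<Rightarrow> 'u::euclidean_space set \<Rightarrow> 'x set \<Rightarrow> ('x \<Rightarrow> 'u \<Rightarrow> 'x) \<Rightarrow>
      ('x \<Rightarrow> 'u \<Rightarrow> real) \<Rightarrow> real \<Rightarrow> (real, 'x, 'u) control_problem" where
  "continuous_time_problem X U XF f r \<tau> =
     \<lparr>time = restrict_space lborel {0..},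
      clock = (\<lambda>t. t),
      states = X,
      failure = XF,
      feedbacks = {u \<in> measurable_feedbacks X U. \<forall>x\<in>X. \<exists>!\<phi>. is_trajectory X XF f u x \<phi>},
      trajectory = (\<lambda>u x. THE \<phi>. is_trajectory X XF f u x \<phi>),
      reward = r,
      discount_rate = \<tau>\<rparr>"


subsection \<open>Discrete time\<close>

definition transition :: "'x set \<Rightarrow> ('x \<Rightarrow> 'u \<Rightarrow> 'x) \<Rightarrow> 'x \<Rightarrow> 'u \<Rightarrow> 'x option" where
  "transition XF f x a = (if x \<in> XF then None else Some (f x a))"

primrec orbit ::
    "'x set \<Rightarrow> ('x \<Rightarrow> 'u \<Rightarrow> 'x) \<Rightarrow> ('x \<Rightarrow> 'u) \<Rightarrow> 'x \<Rightarrow> nat \<Rightarrow> 'x option" where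
  "orbit XF f u x 0 = Some x"
| "orbit XF f u x (Suc t) =
     (case orbit XF f u x t of None \<Rightarrow> None | Some y \<Rightarrow> transition XF f y (u y))"

definition discrete_time_problem ::
    "'x::topological_space set \<Rightarrow> 'u::topological_space set \<Rightarrow> 'x set \<Rightarrow> ('x \<Rightarrow> 'u \<Rightarrow> 'x) \<Rightarrow>
      ('x \<Rightarrow> 'u \<Rightarrow> real) \<Rightarrow> real \<Rightarrow> (nat, 'x, 'u) control_problem" where
  "discrete_time_problem X U XF f r \<tau> =
     \<lparr>time = count_space UNIV,
      clock = real,
      states = X,
      failure = XF,
      feedbacks = measurable_feedbacks X U,
      trajectory = orbit XF f,
      reward = r,
      discount_rate = \<tau>\<rparr>"

text \<open>
  State-control pairs that the dynamics, including the transition of failed states to the sink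
  state, map into \<^term>\<open>K\<close>, and the remaining pairs.
\<close>

definition pairs_into :: "'x set \<Rightarrow> 'u set \<Rightarrow> 'x set \<Rightarrow> ('x \<Rightarrow> 'u \<Rightarrow> 'x) \<Rightarrow> 'x set \<Rightarrow> ('x \<times> 'u) set" where
  "pairs_into X U XF f K = {(x, a). x \<in> X \<and> a \<in> U \<and> transition XF f x a \<in> Some ` K}"

definition pairs_not_into ::
    "'x set \<Rightarrow> 'u set \<Rightarrow> 'x set \<Rightarrow> ('x \<Rightarrow> 'u \<Rightarrow> 'x) \<Rightarrow> 'x set \<Rightarrow> ('x \<times> 'u) set" where
  "pairs_not_into X U XF f K = X \<times> U - pairs_into X U XF f K"

end

theory Submission
  imports Defs
begin

text \<open>
  Because the sink is entered right after failure, a safe controller collects no penalty, so the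
  penalized value dominates the constrained one on the viability kernel; hence an optimal
  controller that is safe is also optimal for the constrained problem.

  In continuous time, suppose that an optimal controller leads from the viability kernel to failure.
  Along this trajectory the penalized value is attained by the same controller, so it is a
  continuous function of time up to and including the failure time.  It starts above the gap and
  ends below it, but takes no value inside the gap, which contradicts the intermediate value
  theorem.

  In discrete time, consider the step at which the optimal controller leaves the viability kernel,
  from a state \<open>y\<close>.  There the penalized value is at most the left-hand side of the condition.
  It is also at least \<open>m\<close>, the infimum of the constrained value, and at least \<open>R / (1 - \<gamma>)\<close> with
  \<open>R\<close> the infimum of the reward over viable pairs, since a safe controller collects at least \<open>R\<close> at
  every step.  The convex combination of these two bounds is \<open>R + \<gamma> * m\<close>.  In this way no dynamic
  programming principle for the constrained problem is needed, which would require switching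
  between controllers.
\<close>

section \<open>Safe controllers and penalized optimality\<close>

text \<open>The problem record leaves trajectories abstract, so the fact that they start at
  \<open>x\<close> enters as the hypothesis that \<open>x\<close> is visited; both time sets supply
  it at time 0.\<close>

lemma failure_unviable:
  assumes "failure P \<subseteq> states P" "x \<in> failure P"
    and "\<And>u. u \<in> feedbacks P \<Longrightarrow> \<exists>t\<in>space (time P). trajectory P u x t = Some x"
  shows "x \<in> unviable_states P"
proof -
  have "\<not> safe_for P u x" if "u \<in> feedbacks P" for u
    using assms(3)[OF that] assms(2) unfolding safe_for_def by force
  then show ?thesis
    using assms(1,2) by (auto simp: unviable_states_def viability_kernel_def)
qed

lemma risk_safe: "safe_for P u x \<Longrightarrow> risk P x u = 0"
proof -
  assume "safe_for P u x"
  then have empty: "{ereal (clock P t) |t. t \<in> space (time P) \<and> trajectory P u x t \<in> Some ` failure P} = {}"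
    by (auto simp: safe_for_def)
  then show ?thesis
    \<comment> \<open>\<open>Inf {}\<close> is \<open>\<infinity>\<close> in \<open>ereal\<close>,
      the value for which \<open>risk\<close> is 0.\<close>
    unfolding risk_def time_to_failure_def empty by (simp add: top_ereal_def)
qed

text \<open>The sink takes over right after failure, so in both time sets the infimum runs over a
  single time.\<close>

lemma time_to_failure_unique:
  assumes "t \<in> space (time P)" "trajectory P u x t \<in> Some ` failure P"
    and "\<And>s. s \<in> space (time P) \<Longrightarrow> trajectory P u x s \<in> Some ` failure P \<Longrightarrow> s = t"
  shows "time_to_failure P x u = ereal (clock P t)"
proof -
  have "{ereal (clock P t) |t. t \<in> space (time P) \<and> trajectory P u x t \<in> Some ` failure P}
      = {ereal (clock P t)}"
    using assms by blast
  then show ?thesis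
    unfolding time_to_failure_def by simp
qed

lemma constrained_value_le_penalized_value:
  assumes "x \<in> viability_kernel P"
  shows "constrained_value P x \<le> penalized_value P p x"
  unfolding constrained_value_def penalized_value_def
proof (rule SUP_mono)
  fix u assume "u \<in> safe_feedbacks P"
  then have "u \<in> feedbacks P" "safe_for P u x"
    using assms by (auto simp: safe_feedbacks_def)
  then show "\<exists>v\<in>feedbacks P. ereal (gain P x u) \<le> ereal (gain P x v - p * risk P x v)"
    by (intro bexI[of _ u]) (auto simp: risk_safe)
qed

text \<open>On the viability kernel the penalty vanishes for both controllers, so penalized
  optimality compares the bare returns state by state; \<open>\<mu>\<close> is concentrated
  there.\<close>

lemma constrained_optimal_if_safe:
  assumes "initial_distribution P \<mu>" "penalized_optimal P p u" "u \<in> safe_feedbacks P"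
  shows "constrained_optimal P \<mu> u"
proof -
  have le: "gain P x v \<le> gain P x u" if "v \<in> safe_feedbacks P" "x \<in> viability_kernel P" for v x
  proof -
    have x: "x \<in> states P" "safe_for P u x" "safe_for P v x" "v \<in> feedbacks P"
      using that assms(3) by (auto simp: safe_feedbacks_def viability_kernel_def)
    have "ereal (gain P x v - p * risk P x v) \<le> penalized_value P p x"
      unfolding penalized_value_def using x by (intro SUP_upper) auto
    also have "\<dots> = ereal (gain P x u - p * risk P x u)"
      using assms(2) x by (simp add: penalized_optimal_def)
    finally show ?thesis
      using x by (simp add: risk_safe)
  qed
  have ae: "AE x in \<mu>. x \<in> viability_kernel P"
    using assms(1) by (simp add: initial_distribution_def)
  have "expected_gain P \<mu> v \<le> expected_gain P \<mu> u" if v: "v \<in> safe_feedbacks P" for v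
    \<comment> \<open>Nonnegative integrals are monotone even for nonmeasurable integrands, and the
      subtracted negative part shrinks as the return grows.\<close>
    unfolding expected_gain_def
  proof (rule ereal_minus_mono)
    show "enn2ereal (\<integral>\<^sup>+ x. ennreal (gain P x v) \<partial>\<mu>) \<le> enn2ereal (\<integral>\<^sup>+ x. ennreal (gain P x u) \<partial>\<mu>)"
      unfolding less_eq_ennreal.rep_eq[symmetric]
      using ae by (intro nn_integral_mono_AE) (auto elim!: eventually_mono intro!: ennreal_leI le v)
    show "enn2ereal (\<integral>\<^sup>+ x. ennreal (- gain P x u) \<partial>\<mu>) \<le> enn2ereal (\<integral>\<^sup>+ x. ennreal (- gain P x v) \<partial>\<mu>)"
      unfolding less_eq_ennreal.rep_eq[symmetric]
      using ae by (intro nn_integral_mono_AE) (auto elim!: eventually_mono intro!: ennreal_leI le v)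
  qed
  then have "expected_gain P \<mu> u = (SUP v\<in>safe_feedbacks P. expected_gain P \<mu> v)"
    using assms(3) by (intro antisym SUP_upper SUP_least) auto
  then show ?thesis
    using assms(3) by (simp add: constrained_optimal_def)
qed

section \<open>Continuous time\<close>

lemma is_trajectory_hit_unique:
  assumes "is_trajectory X XF f u x \<phi>"
    and "s \<ge> 0" "\<phi> s \<in> Some ` XF" "t \<ge> 0" "\<phi> t \<in> Some ` XF"
  shows "s = t"
proof -
  have False if "a < b" "a \<ge> 0" "\<phi> a \<in> Some ` XF" "\<phi> b \<in> Some ` XF" for a b
  proof -
    have "\<phi> b = None"
      using assms(1) that unfolding is_trajectory_def by auto
    then show False using that by auto
  qed
  then show ?thesis
    using assms by (metis linorder_neqE_linordered_idom)
qed

text \<open>The closed loop is autonomous, so the tail of a solution solves the same equation from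
  the state reached. Restricting to \<open>{0..}\<close> meets the extensionality that makes
  trajectories unique as functions.\<close>

lemma is_trajectory_shift:
  assumes \<phi>: "is_trajectory X XF f u x \<phi>" and t: "t \<ge> 0" "\<phi> t = Some y"
  shows "is_trajectory X XF f u y (\<lambda>s\<in>{0..}. \<phi> (t + s))"
proof -
  let ?\<psi> = "\<lambda>s\<in>{0..}. \<phi> (t + s)"
  define z where "z = (\<lambda>t. the (\<phi> t))"
  define I where "I = {t. 0 \<le> t \<and> \<phi> t \<noteq> None}"
  have none: "\<And>t. t \<ge> 0 \<Longrightarrow> \<phi> t = None \<longleftrightarrow> (\<exists>s\<in>{0..<t}. \<phi> s \<in> Some ` XF)"
    and X: "z ` I \<subseteq> X" and cont: "continuous_on I z"
    and int: "\<And>t. t \<in> I \<Longrightarrow> ((\<lambda>s. f (z s) (u (z s))) has_integral (z t - x)) {0..t}"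
    using \<phi> unfolding is_trajectory_def Let_def z_def I_def by auto
  \<comment> \<open>Not being in the sink at \<open>t\<close> excludes earlier failure, so the
    failures of the shifted path are those of the original one, moved by \<open>t\<close>.\<close>
  have nohit: "\<phi> s \<notin> Some ` XF" if "0 \<le> s" "s < t" for s
    using none[of t] t that by auto
  have none': "?\<psi> s = None \<longleftrightarrow> (\<exists>a\<in>{0..<s}. ?\<psi> a \<in> Some ` XF)" if "s \<ge> 0" for s
  proof -
    have "(\<exists>a\<in>{0..<t + s}. \<phi> a \<in> Some ` XF) \<longleftrightarrow> (\<exists>a\<in>{0..<s}. \<phi> (t + a) \<in> Some ` XF)"
    proof
      assume "\<exists>a\<in>{0..<t + s}. \<phi> a \<in> Some ` XF"
      then obtain a where a: "0 \<le> a" "a < t + s" "\<phi> a \<in> Some ` XF" by auto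
      with nohit have "a \<ge> t" by force
      with a show "\<exists>a\<in>{0..<s}. \<phi> (t + a) \<in> Some ` XF"
        by (intro bexI[of _ "a - t"]) auto
    next
      assume "\<exists>a\<in>{0..<s}. \<phi> (t + a) \<in> Some ` XF"
      then obtain a where "0 \<le> a" "a < s" "\<phi> (t + a) \<in> Some ` XF" by auto
      with t show "\<exists>a\<in>{0..<t + s}. \<phi> a \<in> Some ` XF"
        by (intro bexI[of _ "t + a"]) auto
    qed
    with none[of "t + s"] that t show ?thesis by auto
  qed
  define J where "J = {s. 0 \<le> s \<and> ?\<psi> s \<noteq> None}"
  have J: "J = {s. 0 \<le> s \<and> t + s \<in> I}"
    using t by (auto simp: J_def I_def)
  have z': "the (?\<psi> s) = z (t + s)" if "s \<ge> 0" for s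
    using that by (simp add: z_def)
  have "continuous_on J (\<lambda>s. z (t + s))"
    using J by (intro continuous_on_compose2[OF cont] continuous_intros) auto
  then have cont': "continuous_on J (\<lambda>s. the (?\<psi> s))"
    by (rule continuous_on_eq) (use z' J in auto)
  have "((\<lambda>s. f (the (?\<psi> s)) (u (the (?\<psi> s)))) has_integral (the (?\<psi> s) - y)) {0..s}"
    if s: "s \<in> J" for s
  proof -
    let ?F = "\<lambda>s. f (z s) (u (z s))"
    have s': "s \<ge> 0" "t + s \<in> I" and tI: "t \<in> I"
      using s t by (auto simp: J I_def)
    \<comment> \<open>The increment from \<open>y\<close> is the integral over
      \<open>{0..t + s}\<close> minus the one over \<open>{0..t}\<close>; translation by
      \<open>t\<close> then moves it to \<open>{0..s}\<close>.\<close>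
    have i1: "(?F has_integral (z (t + s) - x)) {0..t + s}" and i2: "(?F has_integral (y - x)) {0..t}"
      using int[OF s'(2)] int[OF tI] t by (auto simp: z_def)
    have i3: "?F integrable_on {t..t + s}"
      using i1 t by (meson has_integral_integrable integrable_on_subinterval atLeastatMost_subset_iff order_refl)
    have "integral {0..t} ?F + integral {t..t + s} ?F = integral {0..t + s} ?F"
      using i1 t s' by (intro Henstock_Kurzweil_Integration.integral_combine) auto
    then have "integral {t..t + s} ?F = z (t + s) - y"
      using integral_unique[OF i1] integral_unique[OF i2] by (simp add: algebra_simps)
    then have "(?F has_integral (z (t + s) - y)) {t..t + s}"
      using i3 by (metis integrable_integral)
    then have "((\<lambda>a. ?F (a + t)) has_integral (z (t + s) - y)) {t - t..t + s - t}"
      by (rule has_integral_shift_real_ivl)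
    then have "((\<lambda>a. ?F (t + a)) has_integral (z (t + s) - y)) {0..s}"
      by (simp add: add.commute)
    then have "((\<lambda>a. f (the (?\<psi> a)) (u (the (?\<psi> a)))) has_integral (z (t + s) - y)) {0..s}"
      by (rule has_integral_eq[rotated]) (auto simp: z_def)
    then show ?thesis
      using z'[OF s'(1)] by simp
  qed
  moreover have "(\<lambda>s. the (?\<psi> s)) ` J \<subseteq> X"
    using X z' by (auto simp: J)
  ultimately show ?thesis
    using none' cont' t unfolding is_trajectory_def Let_def J_def by auto
qed

locale continuous_time =
  fixes X XF :: "'x::euclidean_space set" and U :: "'u::euclidean_space set"
    and f :: "'x \<Rightarrow> 'u \<Rightarrow> 'x" and r :: "'x \<Rightarrow> 'u \<Rightarrow> real" and \<tau> :: real
    and C :: "(real, 'x, 'u) control_problem"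
  assumes C: "C = continuous_time_problem X U XF f r \<tau>"
    and \<tau>: "\<tau> > 0"
    and XF: "failure_set X XF"
    and r: "bounded_measurable_reward X U r"
begin

lemma C_sel [simp]:
  "time C = restrict_space lborel {0..}" "clock C = (\<lambda>t. t)" "states C = X" "failure C = XF"
  "reward C = r" "discount_rate C = \<tau>"
  by (simp_all add: C continuous_time_problem_def)

lemma space_time [simp]: "space (restrict_space lborel {0::real..}) = {0..}"
  by (simp add: space_restrict_space)

text \<open>Admissible feedbacks have exactly one trajectory from each state, so any solution
  exhibited is the one selected; for shifted solutions this yields the flow property.\<close>

lemma trajectory_unique:
  assumes "u \<in> feedbacks C" "x \<in> X" "is_trajectory X XF f u x \<phi>"
  shows "trajectory C u x = \<phi>"
proof -
  have "\<exists>!\<phi>. is_trajectory X XF f u x \<phi>"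
    using assms by (auto simp: C continuous_time_problem_def)
  then show ?thesis
    using assms(3) by (simp add: C continuous_time_problem_def the1_equality)
qed

lemma is_trajectory_trajectory:
  assumes "u \<in> feedbacks C" "x \<in> X"
  shows "is_trajectory X XF f u x (trajectory C u x)"
proof -
  have "\<exists>!\<phi>. is_trajectory X XF f u x \<phi>"
    using assms by (auto simp: C continuous_time_problem_def)
  then show ?thesis
    using trajectory_unique[OF assms] by auto
qed

lemma trajectory_in_states:
  assumes "u \<in> feedbacks C" "x \<in> X" "t \<ge> 0" "trajectory C u x t = Some y"
  shows "y \<in> X"
proof -
  have "(\<lambda>t. the (trajectory C u x t)) ` {t. 0 \<le> t \<and> trajectory C u x t \<noteq> None} \<subseteq> X"
    using is_trajectory_trajectory[OF assms(1,2)] by (auto simp: is_trajectory_def Let_def)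
  then have "the (trajectory C u x t) \<in> X"
    using assms(3,4) by blast
  then show ?thesis
    using assms(4) by simp
qed

lemma trajectory_shift:
  assumes "u \<in> feedbacks C" "x \<in> X" "t \<ge> 0" "trajectory C u x t = Some y"
  shows "trajectory C u y = (\<lambda>s\<in>{0..}. trajectory C u x (t + s))"
  using assms
  by (intro trajectory_unique is_trajectory_shift[OF is_trajectory_trajectory])
     (auto intro: trajectory_in_states)

lemma trajectory_defined_iff:
  assumes "u \<in> feedbacks C" "x \<in> X" "T \<ge> 0" "trajectory C u x T \<in> Some ` XF" "t \<ge> 0"
  shows "trajectory C u x t \<noteq> None \<longleftrightarrow> t \<le> T"
proof -
  note tr = is_trajectory_trajectory[OF assms(1,2)]
  have none: "trajectory C u x t = None \<longleftrightarrow> (\<exists>s\<in>{0..<t}. trajectory C u x s \<in> Some ` XF)"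
    using tr assms(5) by (auto simp: is_trajectory_def)
  also have "\<dots> \<longleftrightarrow> T < t"
  proof
    assume "\<exists>s\<in>{0..<t}. trajectory C u x s \<in> Some ` XF"
    then obtain s where s: "0 \<le> s" "s < t" "trajectory C u x s \<in> Some ` XF" by auto
    from is_trajectory_hit_unique[OF tr s(1,3) assms(3,4)] s(2) show "T < t" by simp
  qed (use assms(3,4) in auto)
  finally show ?thesis by auto
qed

section \<open>Return and risk of a trajectory that fails\<close>

definition discounted_reward :: "('x \<Rightarrow> 'u) \<Rightarrow> 'x \<Rightarrow> real \<Rightarrow> real" where
  "discounted_reward u x s =
     exp (- s / \<tau>) * r (the (trajectory C u x s)) (u (the (trajectory C u x s)))"

text \<open>The state is continuous up to \<open>T\<close>, while feedback and reward are only
  measurable; the composition is measurable and bounded on an interval of finite length.\<close>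

lemma set_integrable_discounted_reward:
  assumes u: "u \<in> feedbacks C" and x: "x \<in> X" and T: "T \<ge> 0" "trajectory C u x T \<in> Some ` XF"
  shows "set_integrable lborel {0..T} (discounted_reward u x)"
proof -
  define z where "z = (\<lambda>s. the (trajectory C u x s))"
  note tr = is_trajectory_trajectory[OF u x]
  have "0 \<le> t \<and> trajectory C u x t \<noteq> None \<longleftrightarrow> t \<in> {0..T}" for t
    using trajectory_defined_iff[OF u x T, of t] by auto
  then have I: "{t. 0 \<le> t \<and> trajectory C u x t \<noteq> None} = {0..T}"
    by blast
  have zX: "z s \<in> X" if "s \<in> {0..T}" for s
    using tr that unfolding is_trajectory_def Let_def I z_def by auto
  have zc: "continuous_on {0..T} z"
    using tr unfolding is_trajectory_def Let_def I z_def by auto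
  have zm: "z \<in> measurable (restrict_space borel {0..T}) (restrict_space borel X)"
    using zX by (intro measurable_restrict_space2 borel_measurable_continuous_on_restrict zc)
      (auto simp: space_restrict_space)
  have um: "u \<in> measurable (restrict_space borel X) (restrict_space borel U)"
    using u by (simp add: C continuous_time_problem_def measurable_feedbacks_def)
  have uU: "u y \<in> U" if "y \<in> X" for y
    using measurable_space[OF um] that by (auto simp: space_restrict_space)
  have "(\<lambda>s. (z s, u (z s))) \<in> measurable (restrict_space borel {0..T})
      (restrict_space borel X \<Otimes>\<^sub>M restrict_space borel U)"
    using zm um by (intro measurable_Pair) (auto intro: measurable_compose)
  from measurable_compose[OF this, of "\<lambda>(x, a). r x a" borel] r
  have rm: "(\<lambda>s. r (z s) (u (z s))) \<in> borel_measurable (restrict_space borel {0..T})"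
    by (simp add: bounded_measurable_reward_def)
  have "(\<lambda>s::real. exp (- s / \<tau>)) \<in> borel_measurable (restrict_space borel {0..T})"
    by (intro measurable_restrict_space1) measurable
  from borel_measurable_times[OF this rm]
  have "(\<lambda>s. indicator {0..T} s *\<^sub>R discounted_reward u x s) \<in> borel_measurable lborel"
    unfolding discounted_reward_def z_def
    by (subst (asm) borel_measurable_restrict_space_iff) auto
  moreover obtain M where M: "\<And>y a. y \<in> X \<Longrightarrow> a \<in> U \<Longrightarrow> \<bar>r y a\<bar> \<le> M"
    using r unfolding bounded_measurable_reward_def bounded_iff by force
  have "\<bar>discounted_reward u x s\<bar> \<le> M" if "s \<in> {0..T}" for s
  proof -
    have "exp (- s / \<tau>) \<le> 1"
      using that \<tau> by simp
    then have "exp (- s / \<tau>) * \<bar>r (z s) (u (z s))\<bar> \<le> 1 * M"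
      using M[OF zX[OF that] uU[OF zX[OF that]]] by (intro mult_mono) auto
    then show ?thesis
      by (simp add: discounted_reward_def z_def abs_mult)
  qed
  ultimately show ?thesis
    unfolding set_integrable_def
    by (intro integrableI_bounded_set[where A="{0..T}" and B=M]) (use T in \<open>auto simp: indicator_def\<close>)
qed

text \<open>The sink collects nothing after \<open>T\<close>, which truncates the integral. The
  gauge integral gives access to translation and to continuity in an endpoint.\<close>

lemma gain_hit:
  assumes u: "u \<in> feedbacks C" and x: "x \<in> X" and T: "T \<ge> 0" "trajectory C u x T \<in> Some ` XF"
  shows "gain C x u = integral {0..T} (discounted_reward u x)"
proof -
  have "gain C x u = (LINT t|lborel. indicator {0..} t *\<^sub>R (exp (- t / \<tau>) *
        (case trajectory C u x t of None \<Rightarrow> 0 | Some y \<Rightarrow> r y (u y))))"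
    unfolding gain_def by (simp add: integral_restrict_space cong: option.case_cong)
  also have "\<dots> = (LINT t:{0..T}|lborel. discounted_reward u x t)"
    unfolding set_lebesgue_integral_def
  proof (rule Bochner_Integration.integral_cong)
    fix t :: real
    show "indicator {0..} t *\<^sub>R (exp (- t / \<tau>) *
        (case trajectory C u x t of None \<Rightarrow> 0 | Some y \<Rightarrow> r y (u y)))
      = indicator {0..T} t *\<^sub>R discounted_reward u x t"
      \<comment> \<open>Outside \<open>{0..T}\<close> both sides are 0, after \<open>T\<close>
        because of the sink; inside, \<open>the\<close> meets a defined state.\<close>
      using trajectory_defined_iff[OF u x T, of t]
      by (cases "t \<ge> 0") (auto simp: discounted_reward_def indicator_def split: option.split)
  qed simp
  also have "\<dots> = integral {0..T} (discounted_reward u x)"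
    by (intro set_borel_integral_eq_integral set_integrable_discounted_reward assms)
  finally show ?thesis .
qed

lemma risk_hit:
  assumes u: "u \<in> feedbacks C" and x: "x \<in> X" and T: "T \<ge> 0" "trajectory C u x T \<in> Some ` XF"
  shows "risk C x u = exp (- T / \<tau>)"
proof -
  have "time_to_failure C x u = ereal (clock C T)"
    using T by (intro time_to_failure_unique)
      (auto dest: is_trajectory_hit_unique[OF is_trajectory_trajectory[OF u x] _ _ T])
  then show ?thesis
    by (simp add: risk_def)
qed

text \<open>From the state reached at \<open>t\<close>, failure comes after the remaining time
  \<open>T - t\<close>. The value becomes an explicit continuous function of \<open>t\<close>; the
  factor \<open>exp (t / \<tau>)\<close> undoes the discount accrued before
  \<open>t\<close>.\<close>

lemma penalized_gain_along_trajectory: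
  assumes u: "u \<in> feedbacks C" and x: "x \<in> X" and T: "trajectory C u x T \<in> Some ` XF"
    and t: "0 \<le> t" "t \<le> T" "trajectory C u x t = Some y"
  shows "gain C y u - p * risk C y u
    = exp (t / \<tau>) * integral {t..T} (discounted_reward u x) - p * exp (- (T - t) / \<tau>)"
proof -
  have y: "y \<in> X"
    using trajectory_in_states[OF u x] t by auto
  note shift = trajectory_shift[OF u x t(1,3)]
  have hit: "T - t \<ge> 0" "trajectory C u y (T - t) \<in> Some ` XF"
    using T t by (auto simp: shift)
  have "gain C y u = integral {0..T - t} (discounted_reward u y)"
    by (rule gain_hit[OF u y hit])
  also have "\<dots> = integral {0..T - t} ((\<lambda>s. exp (t / \<tau>) * discounted_reward u x s) \<circ> ((+) t))"
  proof (rule Henstock_Kurzweil_Integration.integral_cong)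
    fix s assume s: "s \<in> {0..T - t}"
    have "exp (- s / \<tau>) = exp (t / \<tau>) * exp (- (t + s) / \<tau>)"
      unfolding exp_add[symmetric] by (simp flip: add_divide_distrib)
    with s show "discounted_reward u y s = ((\<lambda>s. exp (t / \<tau>) * discounted_reward u x s) \<circ> ((+) t)) s"
      by (simp add: discounted_reward_def shift del: minus_add_distrib)
  qed
  also have "\<dots> = exp (t / \<tau>) * integral {t..T} (discounted_reward u x)"
    unfolding integral_shift_Icc_real by simp
  finally show ?thesis
    using risk_hit[OF u y hit] by simp
qed

lemma optimal_is_safe:
  assumes opt: "penalized_optimal C p u"
    and gap: "(SUP x\<in>unviable_states C. penalized_value C p x)
        < (INF x\<in>viability_kernel C. constrained_value C x)"
  shows "u \<in> safe_feedbacks C"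
proof (rule ccontr)
  assume "u \<notin> safe_feedbacks C"
  moreover have u: "u \<in> feedbacks C"
    using opt by (simp add: penalized_optimal_def)
  ultimately obtain x where xV: "x \<in> viability_kernel C" and ns: "\<not> safe_for C u x"
    by (auto simp: safe_feedbacks_def)
  from ns obtain T where T: "T \<ge> 0" "trajectory C u x T \<in> Some ` XF"
    by (auto simp: safe_for_def)
  have x: "x \<in> X"
    using xV by (simp add: viability_kernel_def)
  \<comment> \<open>The two bounds may be infinite; the intermediate value theorem gets a real level
    strictly between them.\<close>
  obtain c where c: "(SUP x\<in>unviable_states C. penalized_value C p x) < ereal c"
    "ereal c < (INF x\<in>viability_kernel C. constrained_value C x)"
    using ereal_dense2[OF gap] by auto
  define J where "J = (\<lambda>y. gain C y u - p * risk C y u)"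
  have J: "ereal (J y) = penalized_value C p y" if "y \<in> X" for y
    using opt that by (simp add: penalized_optimal_def J_def)
  have above: "c < J y" if "y \<in> viability_kernel C" for y
  proof -
    have "ereal c < constrained_value C y"
      using c(2) that by (meson INF_lower less_le_trans)
    also have "\<dots> \<le> ereal (J y)"
      using that constrained_value_le_penalized_value[OF that, of p]
      by (subst J) (auto simp: viability_kernel_def)
    finally show ?thesis by simp
  qed
  have below: "J y < c" if "y \<in> unviable_states C" for y
  proof -
    have "ereal (J y) \<le> (SUP x\<in>unviable_states C. penalized_value C p x)"
      using that by (subst J) (auto simp: unviable_states_def intro: SUP_upper)
    with c(1) have "ereal (J y) < ereal c" by (rule le_less_trans[rotated])
    then show ?thesis by simp
  qed
  define h where "h = (\<lambda>t. exp (t / \<tau>) * integral {t..T} (discounted_reward u x)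
      - p * exp (- (T - t) / \<tau>))"
  have h: "\<exists>y\<in>X. trajectory C u x t = Some y \<and> h t = J y" if t: "0 \<le> t" "t \<le> T" for t
  proof -
    obtain y where y: "trajectory C u x t = Some y"
      using trajectory_defined_iff[OF u x T t(1)] t by auto
    then show ?thesis
      using penalized_gain_along_trajectory[OF u x T(2) t y, of p] trajectory_in_states[OF u x t(1) y]
      by (auto simp: h_def J_def)
  qed
  have "discounted_reward u x integrable_on {0..T}"
    using set_borel_integral_eq_integral(1)[OF set_integrable_discounted_reward[OF u x T]] .
  then have "continuous_on {0..T} h"
    unfolding h_def using \<tau>
    by (intro continuous_intros indefinite_integral_continuous_1') auto
  moreover have "h 0 = J x"
    using h[of 0] T is_trajectory_trajectory[OF u x] by (auto simp: is_trajectory_def)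
  then have "c \<le> h 0"
    using above[OF xV] by simp
  \<comment> \<open>At \<open>T\<close> the trajectory is still in the state space, at a failed and
    hence unviable state.\<close>
  moreover have "h T \<le> c"
  proof -
    obtain y where y: "y \<in> XF" "h T = J y"
      using h[of T] T by auto
    have XFX: "XF \<subseteq> X"
      using XF by (simp add: failure_set_def)
    have "y \<in> unviable_states C"
    proof (rule failure_unviable)
      fix v assume "v \<in> feedbacks C"
      then have "is_trajectory X XF f v y (trajectory C v y)"
        using y XFX by (intro is_trajectory_trajectory) auto
      then show "\<exists>t\<in>space (time C). trajectory C v y t = Some y"
        by (intro bexI[of _ 0]) (auto simp: is_trajectory_def)
    qed (use XFX y in auto)
    then show ?thesis
      using below y(2) by force
  qed
  ultimately obtain t where t: "0 \<le> t" "t \<le> T" "h t = c"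
    using IVT2'[of h T c 0] T by auto
  then obtain y where "y \<in> X" "J y = c"
    using h by force
  \<comment> \<open>Every state of \<open>X\<close> is viable or unviable, so \<open>J\<close>
    cannot take the value \<open>c\<close>.\<close>
  then show False
    using above[of y] below[of y] by (auto simp: unviable_states_def)
qed

end

section \<open>Discrete time\<close>

text \<open>\<open>orbit\<close> appends its last step; recursions in the initial state need the
  first step split off.\<close>

lemma orbit_Suc_left:
  "orbit XF f u x (Suc t) = (if x \<in> XF then None else orbit XF f u (f x (u x)) t)"
proof (induction t)
  case 0
  show ?case by (simp add: transition_def)
next
  case (Suc t)
  then show ?case by (subst orbit.simps(2)) simp
qed

lemma orbit_after_hit:
  assumes "orbit XF f u x s \<in> Some ` XF" "s < t"
  shows "orbit XF f u x t = None"
  using assms(2)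
proof (induction t)
  case (Suc t)
  then show ?case
    using assms(1) by (cases "s = t") (auto simp: transition_def)
qed simp

lemma orbit_hit_unique:
  assumes "orbit XF f u x s \<in> Some ` XF" "orbit XF f u x t \<in> Some ` XF"
  shows "s = t"
  using assms orbit_after_hit[of XF f u x] by (metis imageE linorder_neqE_nat option.distinct(1))

locale discrete_time =
  fixes Y YF :: "'y::topological_space set" and W :: "'w::topological_space set"
    and g :: "'y \<Rightarrow> 'w \<Rightarrow> 'y" and q :: "'y \<Rightarrow> 'w \<Rightarrow> real" and \<tau> \<gamma> :: real
    and D :: "(nat, 'y, 'w) control_problem"
  assumes D: "D = discrete_time_problem Y W YF g q \<tau>"
    and \<tau>: "\<tau> > 0" and \<gamma>: "\<gamma> = exp (- 1 / \<tau>)"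
    and YF: "failure_set Y YF"
    and g: "\<forall>y\<in>Y - YF. \<forall>a\<in>W. g y a \<in> Y"
    and q: "bounded_measurable_reward Y W q"
begin

lemma D_sel [simp]:
  "time D = count_space UNIV" "clock D = real" "states D = Y" "failure D = YF"
  "reward D = q" "discount_rate D = \<tau>" "feedbacks D = measurable_feedbacks Y W"
  "trajectory D = orbit YF g"
  by (simp_all add: D discrete_time_problem_def)

lemma \<gamma>_bounds: "0 < \<gamma>" "\<gamma> < 1"
  using \<tau> by (auto simp: \<gamma>)

lemma exp_discount: "exp (- real t / \<tau>) = \<gamma> ^ t"
  by (simp add: \<gamma> flip: exp_of_nat_mult)

lemma feedback_in: "u \<in> measurable_feedbacks Y W \<Longrightarrow> y \<in> Y \<Longrightarrow> u y \<in> W"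
  by (auto simp: measurable_feedbacks_def space_restrict_space dest!: measurable_space[where x=y])

lemma reward_bound: obtains M where "\<And>y a. y \<in> Y \<Longrightarrow> a \<in> W \<Longrightarrow> \<bar>q y a\<bar> \<le> M"
  using q unfolding bounded_measurable_reward_def bounded_iff by force

lemma orbit_in_states:
  assumes "u \<in> measurable_feedbacks Y W" "y \<in> Y" "orbit YF g u y t = Some z"
  shows "z \<in> Y"
  using assms(2,3)
proof (induction t arbitrary: y)
  case (Suc t)
  then have "y \<notin> YF" "orbit YF g u (g y (u y)) t = Some z"
    unfolding orbit_Suc_left by (auto split: if_splits)
  with Suc g feedback_in[OF assms(1)] show ?case
    by blast
qed simp

section \<open>Discounted series and their one-step recursions\<close>

definition stage_reward :: "('y \<Rightarrow> 'w) \<Rightarrow> 'y \<Rightarrow> nat \<Rightarrow> real" where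
  "stage_reward u y t = (case orbit YF g u y t of None \<Rightarrow> 0 | Some z \<Rightarrow> q z (u z))"

text \<open>Bounded rewards against a geometric series; absolute summability lets the integral over
  counting measure be read as a series.\<close>

lemma summable_stage_reward:
  assumes u: "u \<in> measurable_feedbacks Y W" and y: "y \<in> Y"
  shows "summable (\<lambda>t. norm (\<gamma> ^ t * stage_reward u y t))"
proof -
  obtain M where M: "\<And>y a. y \<in> Y \<Longrightarrow> a \<in> W \<Longrightarrow> \<bar>q y a\<bar> \<le> M"
    using reward_bound by blast
  \<comment> \<open>The stage reward in the sink is 0, so the bound must be nonnegative.\<close>
  have "M \<ge> 0"
    using M[OF y feedback_in[OF u y]] by simp
  then have "\<bar>stage_reward u y t\<bar> \<le> M" for t
    using M orbit_in_states[OF u y] feedback_in[OF u]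
    by (auto simp: stage_reward_def split: option.split)
  then have "norm (norm (\<gamma> ^ t * stage_reward u y t)) \<le> \<gamma> ^ t * M" for t
    using \<gamma>_bounds by (simp add: abs_mult)
  moreover have "summable (\<lambda>t. \<gamma> ^ t * M)"
    using \<gamma>_bounds by (intro summable_mult2 summable_geometric) auto
  ultimately show ?thesis
    by (rule summable_comparison_test'[rotated])
qed

lemma gain_eq_suminf:
  assumes "u \<in> measurable_feedbacks Y W" "y \<in> Y"
  shows "gain D y u = (\<Sum>t. \<gamma> ^ t * stage_reward u y t)"
proof -
  have "gain D y u = (LINT t|count_space UNIV. \<gamma> ^ t * stage_reward u y t)"
    by (simp add: gain_def stage_reward_def exp_discount[simplified] cong: option.case_cong)
  also have "\<dots> = (\<Sum>t. \<gamma> ^ t * stage_reward u y t)"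
    using summable_stage_reward[OF assms]
    by (intro integral_count_space_nat) (simp add: integrable_count_space_nat_iff)
  finally show ?thesis .
qed

text \<open>The feedback is stationary, so what follows the first step is the orbit of the successor
  under the same controller. From a failed \<open>y\<close> the next state would be the sink instead
  of \<open>g y (u y)\<close>.\<close>

lemma gain_step:
  assumes u: "u \<in> measurable_feedbacks Y W" and y: "y \<in> Y" "y \<notin> YF"
  shows "gain D y u = q y (u y) + \<gamma> * gain D (g y (u y)) u"
proof -
  have y1: "g y (u y) \<in> Y"
    using g y feedback_in[OF u] by blast
  note sm = summable_norm_cancel[OF summable_stage_reward[OF u y(1)]]
    and sm1 = summable_norm_cancel[OF summable_stage_reward[OF u y1]]
  have "stage_reward u y (Suc t) = stage_reward u (g y (u y)) t" for t
    unfolding stage_reward_def orbit_Suc_left using y by simp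
  then have "(\<Sum>t. \<gamma> ^ Suc t * stage_reward u y (Suc t))
      = \<gamma> * (\<Sum>t. \<gamma> ^ t * stage_reward u (g y (u y)) t)"
    using suminf_mult[OF sm1, of \<gamma>] by (simp add: mult.assoc)
  moreover have "stage_reward u y 0 = q y (u y)"
    by (simp add: stage_reward_def)
  ultimately show ?thesis
    using suminf_split_head[OF sm] by (simp add: gain_eq_suminf u y y1)
qed

text \<open>Starting one step earlier, outside \<open>YF\<close>, delays failure by one time unit,
  hence one factor \<open>\<gamma>\<close>; without failure both sides are 0.\<close>

lemma risk_step:
  assumes y: "y \<notin> YF"
  shows "risk D y u = \<gamma> * risk D (g y (u y)) u"
proof (cases "safe_for D u (g y (u y))")
  case True
  have "orbit YF g u y t \<notin> Some ` YF" for t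
    using True y by (cases t) (auto simp: safe_for_def orbit_Suc_left simp del: orbit.simps(2))
  then have "safe_for D u y"
    by (simp add: safe_for_def)
  with True show ?thesis
    by (simp add: risk_safe)
next
  case False
  then obtain t where t: "orbit YF g u (g y (u y)) t \<in> Some ` YF"
    by (auto simp: safe_for_def)
  then have t': "orbit YF g u y (Suc t) \<in> Some ` YF"
    using y unfolding orbit_Suc_left by simp
  have "time_to_failure D (g y (u y)) u = ereal (clock D t)"
    using t by (intro time_to_failure_unique) (auto intro: orbit_hit_unique[OF _ t])
  moreover have "time_to_failure D y u = ereal (clock D (Suc t))"
    using t' by (intro time_to_failure_unique) (auto intro: orbit_hit_unique[OF _ t'] simp del: orbit.simps)
  ultimately show ?thesis
    by (simp add: risk_def exp_discount[simplified] del: of_nat_Suc)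
qed

section \<open>Invariance of the viability kernel\<close>

lemma viable_not_failed:
  assumes "y \<in> viability_kernel D"
  shows "y \<in> Y" "y \<notin> YF"
proof -
  show "y \<in> Y"
    using assms by (simp add: viability_kernel_def)
  show "y \<notin> YF"
  proof
    assume "y \<in> YF"
    then have "y \<in> unviable_states D"
      using YF by (intro failure_unviable) (auto simp: failure_set_def intro: exI[of _ 0])
    with assms show False
      by (simp add: unviable_states_def)
  qed
qed

text \<open>The same controller \<open>v\<close> stays safe from the successor and so witnesses
  viability there.\<close>

lemma safe_step_viable:
  assumes v: "v \<in> measurable_feedbacks Y W" and y: "y \<in> viability_kernel D" and s: "safe_for D v y"
  shows "g y (v y) \<in> viability_kernel D"
proof -
  note y' = viable_not_failed[OF y]
  have "orbit YF g v (g y (v y)) t \<notin> Some ` YF" for t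
  proof -
    have "orbit YF g v y (Suc t) \<notin> Some ` YF"
      using s by (simp add: safe_for_def del: orbit.simps)
    then show ?thesis
      using y' unfolding orbit_Suc_left by simp
  qed
  then have "safe_for D v (g y (v y))"
    by (simp add: safe_for_def)
  moreover have "g y (v y) \<in> Y"
    using y' g feedback_in[OF v] by blast
  ultimately show ?thesis
    using v by (auto simp: viability_kernel_def)
qed

lemma orbit_viable:
  assumes "\<And>y. y \<in> viability_kernel D \<Longrightarrow> g y (v y) \<in> viability_kernel D" "y \<in> viability_kernel D"
  shows "\<exists>z\<in>viability_kernel D. orbit YF g v y t = Some z"
proof (induction t)
  case (Suc t)
  then show ?case
    using assms(1) viable_not_failed(2) by (fastforce simp: transition_def)
qed (use assms(2) in simp)

text \<open>The kernel is disjoint from \<open>YF\<close>, so one-step invariance of it keeps orbits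
  out of failure forever. An unsafe controller therefore leaves the kernel in a single step from
  some viable state.\<close>

lemma safe_feedbacks_iff:
  "u \<in> safe_feedbacks D \<longleftrightarrow> u \<in> measurable_feedbacks Y W \<and>
     (\<forall>y\<in>viability_kernel D. g y (u y) \<in> viability_kernel D)"
proof (intro iffI conjI ballI)
  assume inv: "u \<in> measurable_feedbacks Y W \<and>
     (\<forall>y\<in>viability_kernel D. g y (u y) \<in> viability_kernel D)"
  have "orbit YF g u y t \<notin> Some ` YF" if "y \<in> viability_kernel D" for y t
    using orbit_viable[of u y t] inv that viable_not_failed(2) by fastforce
  with inv show "u \<in> safe_feedbacks D"
    by (simp add: safe_feedbacks_def safe_for_def)
qed (auto simp: safe_feedbacks_def intro: safe_step_viable)

text \<open>A safe orbit stays in the kernel and never meets the sink, so a geometric series bounds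
  the return from below, whatever the sign of \<open>R\<close>.\<close>

lemma safe_gain_ge:
  assumes v: "v \<in> safe_feedbacks D" and y: "y \<in> viability_kernel D"
    and R: "\<And>z. z \<in> viability_kernel D \<Longrightarrow> R \<le> q z (v z)"
  shows "R / (1 - \<gamma>) \<le> gain D y v"
proof -
  have v': "v \<in> measurable_feedbacks Y W"
    using v by (simp add: safe_feedbacks_iff)
  have geo: "(\<lambda>t. \<gamma> ^ t) sums (1 / (1 - \<gamma>))"
    using \<gamma>_bounds by (intro geometric_sums) auto
  have "R \<le> stage_reward v y t" for t
    using orbit_viable[of v y t] v y R by (auto simp: stage_reward_def safe_feedbacks_iff)
  then have "\<gamma> ^ t * R \<le> \<gamma> ^ t * stage_reward v y t" for t
    using \<gamma>_bounds by (intro mult_left_mono) auto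
  moreover have "(\<lambda>t. \<gamma> ^ t * R) sums (1 / (1 - \<gamma>) * R)"
    by (intro sums_mult2 geo)
  moreover have "(\<lambda>t. \<gamma> ^ t * stage_reward v y t) sums gain D y v"
    using summable_norm_cancel[OF summable_stage_reward[OF v' viable_not_failed(1)[OF y]]]
    by (simp add: gain_eq_suminf[OF v' viable_not_failed(1)[OF y]] summable_sums)
  ultimately have "1 / (1 - \<gamma>) * R \<le> gain D y v"
    by (rule sums_le)
  then show ?thesis by simp
qed

lemma optimal_is_safe:
  assumes opt: "penalized_optimal D p u"
    and gap: "(SUP (y, a)\<in>pairs_not_into Y W YF g (viability_kernel D). ereal (q y a))
          + ereal \<gamma> * (SUP y\<in>unviable_states D. penalized_value D p y)
        < (INF (y, a)\<in>pairs_into Y W YF g (viability_kernel D). ereal (q y a))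
          + ereal \<gamma> * (INF y\<in>viability_kernel D. constrained_value D y)"
      (is "?A + _ * ?B < ?R + _ * ?m")
  shows "u \<in> safe_feedbacks D"
proof (rule ccontr)
  assume "u \<notin> safe_feedbacks D"
  moreover have u: "u \<in> measurable_feedbacks Y W"
    using opt by (simp add: penalized_optimal_def)
  ultimately obtain y where yV: "y \<in> viability_kernel D" and y1V: "g y (u y) \<notin> viability_kernel D"
    by (auto simp: safe_feedbacks_iff)
  note y = viable_not_failed[OF yV]
  have y1: "g y (u y) \<in> Y"
    using g y feedback_in[OF u] by blast
  define J where "J = (\<lambda>y. gain D y u - p * risk D y u)"
  have J: "ereal (J y) = penalized_value D p y" if "y \<in> Y" for y
    using opt that by (simp add: penalized_optimal_def J_def)
  \<comment> \<open>\<open>u\<close> attains the penalized value at \<open>y\<close> and at its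
    successor, so the recursion for this single controller bounds the value at \<open>y\<close> by
    the left-hand side of \<open>gap\<close>.\<close>
  have "J y = q y (u y) + \<gamma> * J (g y (u y))"
    by (simp add: J_def gain_step[OF u y] risk_step[OF y(2)] algebra_simps)
  then have "ereal (J y) = ereal (q y (u y)) + ereal \<gamma> * ereal (J (g y (u y)))"
    by simp
  also have "\<dots> \<le> ?A + ereal \<gamma> * ?B"
  proof (intro add_mono ereal_mult_left_mono)
    have "(y, u y) \<in> pairs_not_into Y W YF g (viability_kernel D)"
      using y y1V feedback_in[OF u] by (auto simp: pairs_not_into_def pairs_into_def transition_def)
    from SUP_upper[OF this, of "\<lambda>(y, a). ereal (q y a)"]
    show "ereal (q y (u y)) \<le> ?A" by simp
    show "ereal (J (g y (u y))) \<le> ?B"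
      using y1 y1V by (subst J) (auto simp: unviable_states_def intro: SUP_upper)
  qed (use \<gamma>_bounds in auto)
  also note gap
  finally have lt: "ereal (J y) < ?R + ereal \<gamma> * ?m" .

  obtain M where M: "\<And>y a. y \<in> Y \<Longrightarrow> a \<in> W \<Longrightarrow> \<bar>q y a\<bar> \<le> M"
    using reward_bound by blast
  \<comment> \<open>\<open>w\<close> is safe for \<open>y\<close>, perhaps not elsewhere; its pair
    at \<open>y\<close> keeps the infimum \<open>?R\<close> from being over an empty set, and
    boundedness of the reward then makes \<open>?R\<close> finite.\<close>
  obtain w where w: "w \<in> measurable_feedbacks Y W" "safe_for D w y"
    using yV by (auto simp: viability_kernel_def)
  have "(y, w y) \<in> pairs_into Y W YF g (viability_kernel D)"
    using w y safe_step_viable[OF w(1) yV w(2)] feedback_in[OF w(1)]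
    by (auto simp: pairs_into_def transition_def)
  from INF_lower[OF this, of "\<lambda>(y, a). ereal (q y a)"] have "?R \<le> ereal (q y (w y))"
    by simp
  moreover have "ereal (- M) \<le> ?R"
    using M by (intro INF_greatest) (force simp: pairs_into_def abs_le_iff)
  ultimately obtain R where R: "?R = ereal R"
    by (cases ?R) auto
  have "?m \<le> constrained_value D y"
    using yV by (intro INF_lower)
  also have Vy: "\<dots> \<le> ereal (J y)"
    using constrained_value_le_penalized_value[OF yV, of p] by (simp add: J y)
  finally have mJ: "?m \<le> ereal (J y)" .
  \<comment> \<open>\<open>lt\<close> excludes \<open>- \<infinity>\<close> and \<open>mJ\<close>
    excludes \<open>\<infinity>\<close>.\<close>
  with lt obtain m where m: "?m = ereal m"
    using \<gamma>_bounds R by (cases ?m) auto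
  \<comment> \<open>Viability gives a controller for each state separately. One safe on the whole
    kernel exists because a supremum over the empty set would make \<open>?m\<close> equal to
    \<open>- \<infinity>\<close>.\<close>
  have "safe_feedbacks D \<noteq> {}"
  proof
    assume "safe_feedbacks D = {}"
    then have "constrained_value D y = - \<infinity>"
      by (simp add: constrained_value_def bot_ereal_def)
    with INF_lower[OF yV, of "constrained_value D"] m show False by simp
  qed
  then obtain v where v: "v \<in> safe_feedbacks D" by blast
  have "R \<le> q z (v z)" if z: "z \<in> viability_kernel D" for z
  proof -
    have "(z, v z) \<in> pairs_into Y W YF g (viability_kernel D)"
      using v z viable_not_failed[OF z] feedback_in[of v z]
      by (auto simp: pairs_into_def transition_def safe_feedbacks_iff)
    from INF_lower[OF this, of "\<lambda>(y, a). ereal (q y a)"] show ?thesis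
      using R by simp
  qed
  then have "R / (1 - \<gamma>) \<le> gain D y v"
    by (intro safe_gain_ge v yV)
  moreover have "ereal (gain D y v) \<le> constrained_value D y"
    unfolding constrained_value_def by (intro SUP_upper v)
  then have "gain D y v \<le> J y"
    using Vy by (metis order_trans ereal_less_eq(3))
  ultimately have "R / (1 - \<gamma>) \<le> J y"
    by (rule order_trans)
  \<comment> \<open>The two bounds on \<open>J y\<close>, with weights \<open>1 - \<gamma>\<close>
    and \<open>\<gamma>\<close>, add up to the negation of \<open>lt\<close>.\<close>
  then have "R \<le> (1 - \<gamma>) * J y"
    using \<gamma>_bounds by (simp add: pos_divide_le_eq mult.commute)
  moreover have "\<gamma> * m \<le> \<gamma> * J y"
    using mJ m \<gamma>_bounds by simp
  ultimately have "R + \<gamma> * m \<le> J y"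
    by (simp add: algebra_simps)
  with lt R m show False by simp
qed

end

theorem theorem1:
  fixes X XF :: "'x::euclidean_space set" and U :: "'u::euclidean_space set"
    and f :: "'x \<Rightarrow> 'u \<Rightarrow> 'x" and r :: "'x \<Rightarrow> 'u \<Rightarrow> real"
    and C :: "(real, 'x, 'u) control_problem" and \<mu> :: "'x measure"
  fixes Y YF :: "'y::t1_space set" and W :: "'w::topological_space set"
    and g :: "'y \<Rightarrow> 'w \<Rightarrow> 'y" and q :: "'y \<Rightarrow> 'w \<Rightarrow> real"
    and D :: "(nat, 'y, 'w) control_problem" and \<nu> :: "'y measure"
  fixes p \<tau> \<gamma> :: real
  assumes "p \<ge> 0" and "\<tau> > 0" and "\<gamma> = exp (- 1 / \<tau>)"
    and "C = continuous_time_problem X U XF f r \<tau>"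
    and "D = discrete_time_problem Y W YF g q \<tau>"
  shows
    "(failure_set X XF \<and>
      bounded_measurable_reward X U r \<and>
      initial_distribution C \<mu> \<and>
      penalized_value_attained C p \<and>
      (SUP x\<in>unviable_states C. penalized_value C p x)
        < (INF x\<in>viability_kernel C. constrained_value C x)
      \<longrightarrow> safe_value_function C \<mu> p)
     \<and>
     (failure_set Y YF \<and>
      (\<forall>y\<in>Y - YF. \<forall>a\<in>W. g y a \<in> Y) \<and>
      bounded_measurable_reward Y W q \<and>
      initial_distribution D \<nu> \<and>
      penalized_value_attained D p \<and>
      (SUP (y, a)\<in>pairs_not_into Y W YF g (viability_kernel D). ereal (q y a))
          + ereal \<gamma> * (SUP y\<in>unviable_states D. penalized_value D p y)
        < (INF (y, a)\<in>pairs_into Y W YF g (viability_kernel D). ereal (q y a))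
          + ereal \<gamma> * (INF y\<in>viability_kernel D. constrained_value D y)
      \<longrightarrow> safe_value_function D \<nu> p)"
proof (intro conjI impI; elim conjE)
  assume *: "failure_set X XF" "bounded_measurable_reward X U r" "initial_distribution C \<mu>"
    "(SUP x\<in>unviable_states C. penalized_value C p x)
        < (INF x\<in>viability_kernel C. constrained_value C x)"
  interpret continuous_time X XF U f r \<tau> C
    using assms * by unfold_locales auto
  show "safe_value_function C \<mu> p"
    unfolding safe_value_function_def
    using optimal_is_safe[OF _ *(4)] constrained_optimal_if_safe[OF *(3)] by blast
next
  assume *: "failure_set Y YF" "\<forall>y\<in>Y - YF. \<forall>a\<in>W. g y a \<in> Y" "bounded_measurable_reward Y W q"
    "initial_distribution D \<nu>"
    "(SUP (y, a)\<in>pairs_not_into Y W YF g (viability_kernel D). ereal (q y a))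
          + ereal \<gamma> * (SUP y\<in>unviable_states D. penalized_value D p y)
        < (INF (y, a)\<in>pairs_into Y W YF g (viability_kernel D). ereal (q y a))
          + ereal \<gamma> * (INF y\<in>viability_kernel D. constrained_value D y)"
  interpret discrete_time Y YF W g q \<tau> \<gamma> D
    using assms * by unfold_locales auto
  show "safe_value_function D \<nu> p"
    unfolding safe_value_function_def
    using optimal_is_safe[OF _ *(5)] constrained_optimal_if_safe[OF *(4)] by blast
qed

end
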